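(* Let $(W,S)$ be a right-angled Coxeter system. If $w\in W$ is such that $w\neq 1$, then $w$ has the ancestor property, i.e. there is a unique non-trivial involution of maximal length in the set $[1,w]=\{x\in W\mid x\leq_R w\}$.
   Context: A right-angled Coxeter matrix on a set $S$ is a function $m:S\times S\to\mathbb{N}\cup\{\infty\}$ with $m(r,s)=m(s,r)$, $m(r,s)=1$ if and only if $r=s$, and $m(r,s)\in\{2,\infty\}$ for $r\neq s$. A right-angled Coxeter system is a pair $(W,S)$ where $W$ is a group, $S\subseteq W$, and $W\cong\langle s\in S\mid (rs)^{m(r,s)}=1 \text{ for all } r,s\in S\rangle$ (via the identity on $S$) for a right-angled Coxeter matrix $m$, relations with $m(r,s)=\infty$ being omitted. $S$ is not assumed finite. $\ell$ denotes the length function with respect to $S$. The weak right order $\leq_R$ is defined by $x\leq_R w$ if and only if $\ell(w)=\ell(x)+\ell(x^{-1}w)$. A non-trivial involution is an element $x\ne 1$ with $x^2=1$. An element $w\in W$ has the ancestor property if there is exactly one element of $[1,w]$ that is a non-trivial involution of maximal length among the non-trivial involutions in $[1,w]$. *)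

theory Defs
  imports "HOL-Algebra.Group" "HOL-Library.Extended_Nat"
begin

section \<open>Groups given by generators and relators\<close>

text \<open>A letter \<^term>\<open>(s, True)\<close> stands for the generator \<open>s\<close> and \<^term>\<open>(s, False)\<close> for
  its formal inverse.\<close>

type_synonym 'a gword = "('a \<times> bool) list"

abbreviation gwords :: "'a set \<Rightarrow> 'a gword set" where
  "gwords S \<equiv> lists (S \<times> UNIV)"

inductive_set pres_rel :: "'a set \<Rightarrow> 'a gword set \<Rightarrow> ('a gword \<times> 'a gword) set"
  for S :: "'a set" and R :: "'a gword set" where
  refl: "u \<in> gwords S \<Longrightarrow> (u, u) \<in> pres_rel S R"
| sym: "(u, v) \<in> pres_rel S R \<Longrightarrow> (v, u) \<in> pres_rel S R"
| trans: "(u, v) \<in> pres_rel S R \<Longrightarrow> (v, w) \<in> pres_rel S R \<Longrightarrow> (u, w) \<in> pres_rel S R"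
| cancel: "u \<in> gwords S \<Longrightarrow> v \<in> gwords S \<Longrightarrow> s \<in> S \<Longrightarrow>
    (u @ [(s, b), (s, \<not> b)] @ v, u @ v) \<in> pres_rel S R"
| relator: "u \<in> gwords S \<Longrightarrow> v \<in> gwords S \<Longrightarrow> r \<in> R \<Longrightarrow> r \<in> gwords S \<Longrightarrow>
    (u @ r @ v, u @ v) \<in> pres_rel S R"

definition pres_class :: "'a set \<Rightarrow> 'a gword set \<Rightarrow> 'a gword \<Rightarrow> 'a gword set" where
  "pres_class S R u = pres_rel S R `` {u}"

definition presented_group :: "'a set \<Rightarrow> 'a gword set \<Rightarrow> 'a gword set monoid" where
  "presented_group S R =
    \<lparr>carrier = gwords S // pres_rel S R,
     mult = (\<lambda>X Y. \<Union>x\<in>X. \<Union>y\<in>Y. pres_class S R (x @ y)),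
     one = pres_class S R []\<rparr>"

section \<open>Right-angled Coxeter systems\<close>

text \<open>Only the values of the matrix on \<open>S \<times> S\<close> are relevant.\<close>

definition right_angled_coxeter_matrix :: "'a set \<Rightarrow> ('a \<Rightarrow> 'a \<Rightarrow> enat) \<Rightarrow> bool" where
  "right_angled_coxeter_matrix S m \<longleftrightarrow>
    (\<forall>r\<in>S. \<forall>s\<in>S. m r s = m s r \<and> (m r s = 1 \<longleftrightarrow> r = s) \<and> (r \<noteq> s \<longrightarrow> m r s \<in> {2, \<infinity>}))"

definition coxeter_relators :: "'a set \<Rightarrow> ('a \<Rightarrow> 'a \<Rightarrow> enat) \<Rightarrow> 'a gword set" where
  "coxeter_relators S m =
    {concat (replicate k [(r, True), (s, True)]) | r s k. r \<in> S \<and> s \<in> S \<and> m r s = enat k}"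

definition right_angled_coxeter_system :: "('a, 'b) monoid_scheme \<Rightarrow> 'a set \<Rightarrow> bool" where
  "right_angled_coxeter_system W S \<longleftrightarrow>
    group W \<and> S \<subseteq> carrier W \<and>
    (\<exists>m. right_angled_coxeter_matrix S m \<and>
      (\<exists>\<phi> \<in> iso (presented_group S (coxeter_relators S m)) W.
        \<forall>s\<in>S. \<phi> (pres_class S (coxeter_relators S m) [(s, True)]) = s))"

section \<open>Length, weak order and the ancestor property\<close>

text \<open>As usual for Coxeter systems, the length counts letters from \<open>S\<close> only; the generators are
  their own inverses. \<^const>\<open>Least\<close> is meaningful only for elements of the submonoid generated
  by \<open>S\<close>, which for a Coxeter system is all of \<open>W\<close>.\<close>

definition word_prod :: "('a, 'b) monoid_scheme \<Rightarrow> 'a list \<Rightarrow> 'a" where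
  "word_prod W xs = foldr (\<lambda>x y. x \<otimes>\<^bsub>W\<^esub> y) xs \<one>\<^bsub>W\<^esub>"

definition cox_length :: "('a, 'b) monoid_scheme \<Rightarrow> 'a set \<Rightarrow> 'a \<Rightarrow> nat" where
  "cox_length W S w = (LEAST n. \<exists>xs \<in> lists S. length xs = n \<and> word_prod W xs = w)"

definition weak_le :: "('a, 'b) monoid_scheme \<Rightarrow> 'a set \<Rightarrow> 'a \<Rightarrow> 'a \<Rightarrow> bool" where
  "weak_le W S x w \<longleftrightarrow>
    cox_length W S w = cox_length W S x + cox_length W S (inv\<^bsub>W\<^esub> x \<otimes>\<^bsub>W\<^esub> w)"

definition weak_interval :: "('a, 'b) monoid_scheme \<Rightarrow> 'a set \<Rightarrow> 'a \<Rightarrow> 'a set" where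
  "weak_interval W S w = {x \<in> carrier W. weak_le W S x w}"

definition nontrivial_involution :: "('a, 'b) monoid_scheme \<Rightarrow> 'a \<Rightarrow> bool" where
  "nontrivial_involution W x \<longleftrightarrow> x \<in> carrier W \<and> x \<noteq> \<one>\<^bsub>W\<^esub> \<and> x [^]\<^bsub>W\<^esub> (2::nat) = \<one>\<^bsub>W\<^esub>"

definition ancestor_property :: "('a, 'b) monoid_scheme \<Rightarrow> 'a set \<Rightarrow> 'a \<Rightarrow> bool" where
  "ancestor_property W S w \<longleftrightarrow>
    (\<exists>!x. x \<in> weak_interval W S w \<and> nontrivial_involution W x \<and>
      (\<forall>y \<in> weak_interval W S w. nontrivial_involution W y \<longrightarrow>
        cox_length W S y \<le> cox_length W S x))"

end

theory Submission
  imports Defs "HOL-Library.Multiset" "HOL-Library.Sublist"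
begin

text \<open>A word is determined up to commutations by its projections to pairs of non-commuting letters.
  An element of \<open>W\<close> is a reduced word up to commutations, the weak order says that all
  these projections are prefixes, and an involution is a reduced word all of whose projections are
  palindromes. If \<open>x\<close> and \<open>y\<close> lie below \<open>w\<close>, then for each pair the projections of \<open>x\<close> and \<open>y\<close>
  are prefixes of the same word, so one is a prefix of the other, and the projection of the join of
  \<open>x\<close> and \<open>y\<close> is the longer one. Hence the join of two involutions below \<open>w\<close> is an involution
  below \<open>w\<close>, and two involutions of maximal length coincide with their join.\<close>

section \<open>Words up to commutation\<close>

definition proj :: "'a \<Rightarrow> 'a \<Rightarrow> 'a list \<Rightarrow> 'a list" where
  "proj s t u = filter (\<lambda>x. x = s \<or> x = t) u"

lemma proj_simps [simp]:
  "proj s t [] = []"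
  "proj s t (a # u) = (if a = s \<or> a = t then a # proj s t u else proj s t u)"
  "proj s t (u @ v) = proj s t u @ proj s t v"
  "proj s t (rev u) = rev (proj s t u)"
  "proj s t (remove1 a u) = remove1 a (proj s t u)"
  by (simp_all add: proj_def rev_filter filter_remove1)

lemma set_proj: "set (proj s t u) = set u \<inter> {s, t}"
  by (auto simp: proj_def)

lemma proj_commute: "proj s t u = proj t s u"
  by (simp add: proj_def disj_commute)

text \<open>A letter other than \<open>s\<close> and \<open>t\<close> does not occur in the
  projection, so deleting it there changes nothing. Through this, \<open>fold remove1 u v\<close>
  serves as left division of \<open>v\<close> by a prefix \<open>u\<close>, computed in each
  projection separately.\<close>

lemma proj_fold_remove1:
  "proj s t (fold remove1 u v) = fold remove1 (proj s t u) (proj s t v)"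
proof (induction u arbitrary: v)
  case (Cons a u)
  have "remove1 a (proj s t v) = proj s t v" if "a \<noteq> s" "a \<noteq> t"
    using that by (intro remove1_idem) (auto simp: set_proj)
  then show ?case
    using Cons by auto
qed simp

lemma fold_remove1_append [simp]: "fold remove1 p (p @ r) = r"
  by (induction p) auto

lemma fold_remove1_Nil [simp]: "fold remove1 p [] = []"
  by (induction p) auto

locale commutation =
  fixes C :: "'a \<Rightarrow> 'a \<Rightarrow> bool"
  assumes C_sym: "C s t \<Longrightarrow> C t s"
    and C_irrefl [simp]: "\<not> C s s"
begin

text \<open>This is equality in the partially commutative monoid given by \<open>C\<close>,
  expressed by projections instead of generating swaps. As \<open>C\<close> is irreflexive, the
  pairs with \<open>s = t\<close> take part and record how often each letter occurs.\<close>

definition teq :: "'a list \<Rightarrow> 'a list \<Rightarrow> bool" (infix \<open>\<approx>\<close> 50) where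
  "u \<approx> v \<longleftrightarrow> (\<forall>s t. \<not> C s t \<longrightarrow> proj s t u = proj s t v)"

definition tpre :: "'a list \<Rightarrow> 'a list \<Rightarrow> bool" (infix \<open>\<lesssim>\<close> 50) where
  "u \<lesssim> v \<longleftrightarrow> (\<forall>s t. \<not> C s t \<longrightarrow> prefix (proj s t u) (proj s t v))"

definition front :: "'a \<Rightarrow> 'a list \<Rightarrow> bool" where
  "front s u \<longleftrightarrow> (\<forall>t. \<not> C s t \<longrightarrow> (\<exists>v. proj s t u = s # v))"

text \<open>Two equal letters cancel in the group once commutations make them adjacent, hence the
  condition on every word equivalent to \<open>u\<close>.\<close>

definition reduced :: "'a list \<Rightarrow> bool" where
  "reduced u \<longleftrightarrow> (\<forall>p s r. \<not> u \<approx> p @ [s, s] @ r)"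

lemma teq_refl [simp, intro]: "u \<approx> u"
  by (simp add: teq_def)

lemma teq_sym: "u \<approx> v \<Longrightarrow> v \<approx> u"
  by (simp add: teq_def)

lemma teq_trans [trans]: "u \<approx> v \<Longrightarrow> v \<approx> w \<Longrightarrow> u \<approx> w"
  by (simp add: teq_def)

lemma teq_append: "u \<approx> u' \<Longrightarrow> v \<approx> v' \<Longrightarrow> u @ v \<approx> u' @ v'"
  by (simp add: teq_def)

lemma teq_Cons: "u \<approx> v \<Longrightarrow> a # u \<approx> a # v"
  by (simp add: teq_def)

lemma teq_remove1: "u \<approx> v \<Longrightarrow> remove1 a u \<approx> remove1 a v"
  by (simp add: teq_def)

lemma teq_rev: "u \<approx> v \<Longrightarrow> rev u \<approx> rev v"
  by (simp add: teq_def)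

lemma teq_swap: "C s t \<Longrightarrow> s # t # u \<approx> t # s # u"
  using C_sym by (auto simp: teq_def)

lemma teq_mset:
  assumes "u \<approx> v"
  shows "mset u = mset v"
proof (rule multiset_eqI)
  fix a
  have "count (mset x) a = length (proj a a x)" for x :: "'a list"
    by (induction x) auto
  moreover have "proj a a u = proj a a v"
    using assms by (simp add: teq_def)
  ultimately show "count (mset u) a = count (mset v) a"
    by simp
qed

lemma teq_length: "u \<approx> v \<Longrightarrow> length u = length v"
  using mset_eq_length teq_mset by blast

lemma teq_set: "u \<approx> v \<Longrightarrow> set u = set v"
  using mset_eq_setD teq_mset by blast

section \<open>Letters that commutations can bring to the front\<close>

lemma front_cong: "u \<approx> v \<Longrightarrow> front s u = front s v"
  by (simp add: front_def teq_def)

lemma front_Cons [simp]: "front s (s # u)"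
  by (simp add: front_def)

lemma front_in_set: "front s u \<Longrightarrow> s \<in> set u"
  using set_proj[of s s u] C_irrefl unfolding front_def by fastforce

text \<open>The relevant projections that involve \<open>s\<close> start with \<open>s\<close>
  already; the remaining ones do not contain \<open>s\<close>.\<close>

lemma front_teq:
  assumes "front s u"
  shows "s # remove1 s u \<approx> u"
  unfolding teq_def
proof (intro allI impI)
  fix a b assume ab: "\<not> C a b"
  have front: "proj s t (s # remove1 s u) = proj s t u" if "\<not> C s t" for t
    using assms that unfolding front_def by fastforce
  show "proj a b (s # remove1 s u) = proj a b u"
  proof (cases "a = s \<or> b = s")
    case True
    then show ?thesis
      using front ab C_sym proj_commute by metis
  next
    case False
    then have "s \<notin> set (proj a b u)"
      by (auto simp: set_proj)
    then show ?thesis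
      using False by (auto simp: remove1_idem)
  qed
qed

lemma front_Cons_commute:
  assumes "C s t"
  shows "front s (t # u) = front s u"
proof -
  have "proj s r (t # u) = proj s r u" if "\<not> C s r" for r
    using that assms by auto
  then show ?thesis
    by (simp add: front_def)
qed

lemma front_remove1_commute:
  assumes "C s t"
  shows "front s (remove1 t u) = front s u"
proof -
  have "proj s r (remove1 t u) = proj s r u" if "\<not> C s r" for r
  proof -
    have "t \<notin> set (proj s r u)"
      using that assms by (auto simp: set_proj)
    then show ?thesis
      by (simp add: remove1_idem)
  qed
  then show ?thesis
    by (simp add: front_def)
qed

section \<open>The prefix order and joins below a common word\<close>

lemma tpre_iff_append: "u \<lesssim> v \<longleftrightarrow> (\<exists>r. u @ r \<approx> v)"
proof
  assume "u \<lesssim> v"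
  \<comment> \<open>In each projection, \<open>fold remove1 u v\<close> strips from \<open>v\<close>
    the prefix contributed by \<open>u\<close>.\<close>
  then have "u @ fold remove1 u v \<approx> v"
    unfolding tpre_def teq_def by (fastforce simp: proj_fold_remove1 elim!: prefixE)
  then show "\<exists>r. u @ r \<approx> v" ..
next
  assume "\<exists>r. u @ r \<approx> v"
  then show "u \<lesssim> v"
    unfolding tpre_def teq_def by (metis proj_simps(3) prefixI)
qed

text \<open>Prefixes of one list are comparable. If the projection of \<open>v\<close> is the
  shorter one, removing the letters of \<open>u\<close> leaves nothing to append; otherwise exactly
  the missing suffix is left.\<close>

lemma proj_join:
  assumes "u \<lesssim> w" "v \<lesssim> w" "\<not> C s t"
  shows "proj s t (u @ fold remove1 u v) = proj s t u \<and> prefix (proj s t v) (proj s t u) \<or>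
    proj s t (u @ fold remove1 u v) = proj s t v \<and> prefix (proj s t u) (proj s t v)"
proof -
  have "prefix (proj s t u) (proj s t v) \<or> prefix (proj s t v) (proj s t u)"
    using assms prefix_same_cases unfolding tpre_def by blast
  moreover have "fold remove1 (p @ r) p = []" for p r :: "'a list"
    using fold_remove1_append[of p "[]"] by simp
  ultimately show ?thesis
    by (auto simp: proj_fold_remove1 elim!: prefixE)
qed

lemma palindrome_join:
  assumes "u \<lesssim> w" "v \<lesssim> w" "rev u \<approx> u" "rev v \<approx> v"
  obtains z where "u \<lesssim> z" "v \<lesssim> z" "z \<lesssim> w" "rev z \<approx> z"
proof
  let ?z = "u @ fold remove1 u v"
  note join = proj_join[OF assms(1,2)]
  show "u \<lesssim> ?z" "v \<lesssim> ?z"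
    unfolding tpre_def using join by (metis prefix_order.refl)+
  show "?z \<lesssim> w"
    using assms(1,2) join unfolding tpre_def by metis
  show "rev ?z \<approx> ?z"
    using assms(3,4) join unfolding teq_def by (metis proj_simps(4))
qed

lemma tpre_length: "u \<lesssim> v \<Longrightarrow> length u \<le> length v"
  by (metis length_append le_add1 teq_length tpre_iff_append)

lemma tpre_length_eq:
  assumes "u \<lesssim> v" "length v \<le> length u"
  shows "u \<approx> v"
proof -
  obtain r where r: "u @ r \<approx> v"
    using assms tpre_iff_append by blast
  then have "r = []"
    using assms(2) teq_length[OF r] by (cases r) auto
  with r show ?thesis
    by simp
qed

section \<open>Reduced words and normal forms\<close>

lemma reduced_Nil [simp]: "reduced []"
  using teq_length unfolding reduced_def by fastforce

lemma reduced_cong: "u \<approx> v \<Longrightarrow> reduced u \<Longrightarrow> reduced v"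
  unfolding reduced_def using teq_trans by blast

lemma reduced_rev:
  assumes "reduced u"
  shows "reduced (rev u)"
  unfolding reduced_def
proof (intro allI notI)
  fix p s r assume "rev u \<approx> p @ [s, s] @ r"
  then have "u \<approx> rev r @ [s, s] @ rev p"
    using teq_rev by fastforce
  then show False
    using assms by (auto simp: reduced_def)
qed

lemma reduced_suffix:
  assumes "reduced (u @ v)"
  shows "reduced v"
  unfolding reduced_def
proof (intro allI notI)
  fix p s r assume "v \<approx> p @ [s, s] @ r"
  then have "u @ v \<approx> (u @ p) @ [s, s] @ r"
    using teq_append[of u u] by simp
  then show False
    using assms reduced_def by blast
qed

lemma reduced_prefix: "reduced (u @ v) \<Longrightarrow> reduced u"
  using reduced_suffix[of "rev v" "rev u"] reduced_rev[of "u @ v"] reduced_rev[of "rev u"] by simp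

lemma reduced_remove1: "reduced u \<Longrightarrow> front s u \<Longrightarrow> reduced (remove1 s u)"
  using reduced_suffix[of "[s]" "remove1 s u"] reduced_cong[OF teq_sym[OF front_teq]] by simp

lemma not_front_reduced:
  assumes "reduced (s # u)"
  shows "\<not> front s u"
proof
  assume "front s u"
  then have "s # u \<approx> [] @ [s, s] @ remove1 s u"
    using teq_Cons[OF teq_sym[OF front_teq]] by simp
  then show False
    using assms reduced_def by blast
qed

lemma not_front_remove1: "reduced u \<Longrightarrow> front s u \<Longrightarrow> \<not> front s (remove1 s u)"
  by (rule not_front_reduced) (rule reduced_cong[OF teq_sym[OF front_teq]])

text \<open>Cancel the leading \<open>s\<close> on both sides of a supposed equivalence with
  \<open>p @ [a, a] @ r\<close>. If the first \<open>s\<close> on the right lies in \<open>p\<close>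
  or after the pair, the pair survives and \<open>u\<close> is not reduced; if it belongs to the
  pair, \<open>s\<close> is already at the front of \<open>u\<close>.\<close>

lemma reduced_Cons:
  assumes "reduced u" "\<not> front s u"
  shows "reduced (s # u)"
  unfolding reduced_def
proof (intro allI notI)
  fix p a r assume eq: "s # u \<approx> p @ [a, a] @ r"
  then have u: "u \<approx> remove1 s (p @ [a, a] @ r)"
    using teq_remove1[OF eq, of s] by simp
  consider "s \<in> set p" | "s \<notin> set p" "s \<noteq> a" | "s \<notin> set p" "s = a"
    by blast
  then show False
  proof cases
    case 1
    then show False
      using u assms(1) unfolding reduced_def by (metis remove1_append)
  next
    case 2
    then have "u \<approx> p @ [a, a] @ remove1 s r"
      using u by (simp add: remove1_append)
    then show False
      using assms(1) unfolding reduced_def by blast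
  next
    case 3
    \<comment> \<open>The projection of \<open>p\<close> lacks \<open>s\<close> but begins a list
      with head \<open>s\<close>, so it is empty, and the second \<open>s\<close> of the pair heads
      the projection of \<open>u\<close>.\<close>
    have "\<exists>v. proj s t u = s # v" if t: "\<not> C s t" for t
    proof -
      have eq': "s # proj s t u = proj s t p @ s # s # proj s t r"
        using eq[unfolded teq_def, rule_format, OF t] 3 by simp
      moreover have "s \<notin> set (proj s t p)"
        using 3 by (auto simp: set_proj)
      ultimately show ?thesis
        by (cases "proj s t p") auto
    qed
    then show False
      using assms(2) by (simp add: front_def)
  qed
qed

section \<open>The action of generators on words, and normal forms\<close>

definition act :: "'a \<Rightarrow> 'a list \<Rightarrow> 'a list" where
  "act s u = (if front s u then remove1 s u else s # u)"

text \<open>Since \<open>act\<close> imitates left multiplication by a generator, applying a whole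
  word to the empty word yields a reduced word for the same element, as in van der Waerden's
  method.\<close>

definition nf :: "'a list \<Rightarrow> 'a list" where
  "nf u = foldr act u []"

lemma act_cong: "u \<approx> v \<Longrightarrow> act s u \<approx> act s v"
  by (simp add: act_def front_cong teq_Cons teq_remove1)

lemma foldr_act_cong: "u \<approx> v \<Longrightarrow> foldr act p u \<approx> foldr act p v"
  by (induction p) (auto simp: act_cong)

lemma reduced_act: "reduced u \<Longrightarrow> reduced (act s u)"
  by (simp add: act_def reduced_Cons reduced_remove1)

lemma reduced_foldr_act: "reduced u \<Longrightarrow> reduced (foldr act p u)"
  by (induction p) (auto simp: reduced_act)

lemma reduced_nf: "reduced (nf u)"
  by (simp add: nf_def reduced_foldr_act)

text \<open>Cancelling and then prepending restores the word up to commutations. Reducedness ensures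
  that after a cancellation no further \<open>s\<close> is at the front, which would be cancelled as
  well.\<close>

lemma act_act: "reduced u \<Longrightarrow> act s (act s u) \<approx> u"
  by (simp add: act_def not_front_remove1 front_teq)

text \<open>Prepending or deleting \<open>t\<close> does not affect whether a letter commuting with
  \<open>t\<close> is at the front.\<close>

lemma act_commute:
  assumes "C s t"
  shows "act s (act t u) \<approx> act t (act s u)"
proof -
  have "C t s" "s \<noteq> t"
    using assms C_sym by auto
  then show ?thesis
    using assms
    by (auto simp: act_def front_Cons_commute front_remove1_commute remove1_commute teq_swap)
qed

lemma length_act_le: "length (act s u) \<le> Suc (length u)"
  by (auto simp: act_def length_remove1)

lemma length_nf_le: "length (nf u) \<le> length u"
proof (induction u)
  case (Cons a u)
  then show ?case
    using length_act_le[of a "nf u"] by (simp add: nf_def)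
qed (simp add: nf_def)

text \<open>Each letter lengthens the word by at most one, so full length means that every letter
  was prepended and none cancelled.\<close>

lemma nf_eq_of_length: "length (nf u) = length u \<Longrightarrow> nf u = u"
proof (induction u)
  case (Cons a u)
  have "length (act a (nf u)) = Suc (length u)"
    using Cons.prems by (simp add: nf_def)
  moreover have "length (nf u) = length u"
    using length_act_le[of a "nf u"] length_nf_le[of u] calculation by simp
  ultimately have "act a u = a # u"
    using Cons.IH by (auto simp: act_def length_remove1 split: if_splits)
  then show ?case
    using Cons.IH \<open>length (nf u) = length u\<close> by (simp add: nf_def)
qed (simp add: nf_def)

lemma nf_reduced: "reduced u \<Longrightarrow> nf u = u"
proof (induction u)
  case (Cons a u)
  then show ?case
    using not_front_reduced[of a u] reduced_suffix[of "[a]" u] by (simp add: nf_def act_def)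
qed (simp add: nf_def)

lemma set_nf: "set (nf u) \<subseteq> set u"
proof (induction u)
  case (Cons a u)
  then show ?case
    using set_remove1_subset[of a "nf u"] by (auto simp: nf_def act_def)
qed (simp add: nf_def)

end

section \<open>Right-angled Coxeter groups through reduced words\<close>

text \<open>The last assumption solves the word problem and is where the completeness of the
  defining relations enters. The others say that \<open>S\<close> generates \<open>W\<close> and
  satisfies these relations.\<close>

locale right_angled = group W + commutation C
  for W :: "('a, 'b) monoid_scheme" (structure) and S :: "'a set" and C :: "'a \<Rightarrow> 'a \<Rightarrow> bool" +
  assumes S_carrier: "S \<subseteq> carrier W"
    and generated: "g \<in> carrier W \<Longrightarrow> \<exists>u\<in>lists S. word_prod W u = g"
    and square: "s \<in> S \<Longrightarrow> s \<otimes> s = \<one>"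
    and commute: "s \<in> S \<Longrightarrow> t \<in> S \<Longrightarrow> C s t \<Longrightarrow> s \<otimes> t = t \<otimes> s"
    and nf_well_defined:
      "u \<in> lists S \<Longrightarrow> v \<in> lists S \<Longrightarrow> word_prod W u = word_prod W v \<Longrightarrow> nf u \<approx> nf v"
begin

section \<open>Products of words in the group\<close>

abbreviation wp where "wp \<equiv> word_prod W"

lemma wp_simps [simp]: "wp [] = \<one>" "wp (s # u) = s \<otimes> wp u"
  by (simp_all add: word_prod_def)

lemma wp_closed [simp]: "u \<in> lists S \<Longrightarrow> wp u \<in> carrier W"
  using S_carrier by (induction u) auto

lemma wp_append: "u \<in> lists S \<Longrightarrow> v \<in> lists S \<Longrightarrow> wp (u @ v) = wp u \<otimes> wp v"
proof (induction u)
  case (Cons a u)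
  then show ?case
    using S_carrier by (auto simp: m_assoc subset_iff)
qed simp

lemma wp_rev: "u \<in> lists S \<Longrightarrow> wp (rev u) = inv (wp u)"
proof (induction u)
  case (Cons a u)
  then have a: "a \<in> S" "a \<in> carrier W" "u \<in> lists S"
    using S_carrier by auto
  have "wp (rev (a # u)) = inv (wp u) \<otimes> a"
    using a Cons wp_append[of "rev u" "[a]"] by (simp add: in_lists_conv_set)
  also have "\<dots> = inv (wp u) \<otimes> inv a"
    using inv_equality[OF square[of a]] a by simp
  also have "\<dots> = inv (wp (a # u))"
    using a by (simp add: inv_mult_group)
  finally show ?case .
qed simp

text \<open>All letters before the first \<open>s\<close> commute with it, so \<open>s\<close> can
  be moved past them in the product.\<close>

lemma wp_front:
  "front s u \<Longrightarrow> u \<in> lists S \<Longrightarrow> wp u = s \<otimes> wp (remove1 s u)"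
proof (induction u)
  case (Cons a u)
  show ?case
  proof (cases "a = s")
    case False
    have "C s a"
    proof (rule ccontr)
      assume "\<not> C s a"
      then show False
        using Cons.prems(1) False by (auto simp: front_def dest!: spec[of _ a])
    qed
    then have "front s u"
      using Cons.prems(1) by (simp add: front_Cons_commute)
    moreover from this have "s \<in> S" "a \<in> S" "u \<in> lists S"
      using front_in_set Cons.prems(2) by auto
    moreover from this have "remove1 s u \<in> lists S"
      using notin_set_remove1 by fastforce
    moreover have "s \<in> carrier W" "a \<in> carrier W"
      using calculation S_carrier by auto
    moreover have "wp u = s \<otimes> wp (remove1 s u)"
      using calculation Cons.IH by blast
    moreover have "a \<otimes> s = s \<otimes> a"
      using calculation commute \<open>C s a\<close> by simp
    ultimately show ?thesis
      using False wp_closed[of "remove1 s u"] by (simp add: m_assoc[symmetric] del: wp_closed)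
  qed simp
qed (use front_in_set in fastforce)

lemma wp_teq: "u \<approx> v \<Longrightarrow> u \<in> lists S \<Longrightarrow> wp u = wp v"
proof (induction u arbitrary: v)
  case Nil
  then show ?case
    using teq_length by fastforce
next
  case (Cons a u)
  have "front a v"
    using front_cong[OF Cons.prems(1)] front_Cons by blast
  moreover have "v \<in> lists S"
    using Cons.prems teq_set by fastforce
  moreover have "u \<approx> remove1 a v"
    using teq_remove1[OF Cons.prems(1), of a] by simp
  ultimately show ?case
    using Cons wp_front by simp
qed

lemma lists_nf: "u \<in> lists S \<Longrightarrow> nf u \<in> lists S"
  using set_nf by fastforce

lemma wp_nf: "u \<in> lists S \<Longrightarrow> wp (nf u) = wp u"
proof (induction u)
  case (Cons a u)
  then have u: "nf u \<in> lists S" "a \<in> S" "wp (nf u) = wp u"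
    using lists_nf by auto
  have "wp (act a (nf u)) = a \<otimes> wp (nf u)"
  proof (cases "front a (nf u)")
    case True
    have "remove1 a (nf u) \<in> lists S"
      using u(1) notin_set_remove1 by fastforce
    then show ?thesis
      using True u(1,2) square[of a] S_carrier
      by (simp add: act_def wp_front[OF True] m_assoc[symmetric] subset_iff)
  qed (simp add: act_def)
  then show ?case
    using u by (simp add: nf_def)
qed (simp add: nf_def)

section \<open>Length, weak order and involutions in terms of reduced words\<close>

lemma reduced_word:
  assumes "g \<in> carrier W"
  obtains u where "u \<in> lists S" "reduced u" "wp u = g"
  using generated[OF assms] reduced_nf lists_nf wp_nf by metis

lemma wp_eq_reduced_iff:
  assumes "u \<in> lists S" "v \<in> lists S" "reduced u" "reduced v"
  shows "wp u = wp v \<longleftrightarrow> u \<approx> v"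
  using assms wp_teq nf_well_defined[of u v] nf_reduced by auto

text \<open>Any word for the same element has a normal form equivalent to \<open>u\<close>, and
  normalising never lengthens a word.\<close>

lemma cox_length_reduced:
  assumes "u \<in> lists S" "reduced u"
  shows "cox_length W S (wp u) = length u"
  unfolding cox_length_def
proof (rule Least_equality)
  fix n assume "\<exists>v\<in>lists S. length v = n \<and> wp v = wp u"
  then obtain v where v: "v \<in> lists S" "length v = n" "wp v = wp u"
    by blast
  then have "nf v \<approx> u"
    using nf_well_defined[of v u] assms nf_reduced by simp
  then show "length u \<le> n"
    using v length_nf_le[of v] teq_length by fastforce
qed (use assms in blast)

lemma reduced_if_cox_length:
  assumes "u \<in> lists S" "cox_length W S (wp u) = length u"
  shows "reduced u"
proof -
  have "length (nf u) = length u"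
    using cox_length_reduced[OF lists_nf reduced_nf] assms wp_nf by metis
  then show ?thesis
    using nf_eq_of_length reduced_nf by metis
qed

text \<open>Additivity of lengths says that \<open>u\<close> followed by a reduced word
  \<open>r\<close> for the quotient is again reduced, hence equivalent to \<open>v\<close>.\<close>

lemma weak_le_iff:
  assumes "u \<in> lists S" "v \<in> lists S" "reduced u" "reduced v"
  shows "weak_le W S (wp u) (wp v) \<longleftrightarrow> u \<lesssim> v"
proof
  assume le: "weak_le W S (wp u) (wp v)"
  obtain r where r: "r \<in> lists S" "reduced r" "wp r = inv (wp u) \<otimes> wp v"
    using reduced_word[of "inv (wp u) \<otimes> wp v"] assms by auto
  have eq: "wp (u @ r) = wp v"
    using r assms by (simp add: wp_append m_assoc[symmetric])
  then have "cox_length W S (wp (u @ r)) = length (u @ r)"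
    using le r assms cox_length_reduced[of u] cox_length_reduced[of r]
    by (simp add: weak_le_def)
  then have "u @ r \<approx> v"
    using eq r assms reduced_if_cox_length[of "u @ r"] wp_eq_reduced_iff[of "u @ r" v] by simp
  then show "u \<lesssim> v"
    using tpre_iff_append by blast
next
  assume "u \<lesssim> v"
  then obtain r where r: "u @ r \<approx> v"
    using tpre_iff_append by blast
  have S: "r \<in> lists S" "u @ r \<in> lists S"
    using teq_set[OF r] assms by auto
  have "reduced r"
    using reduced_cong[OF teq_sym[OF r]] assms reduced_suffix by blast
  moreover have "inv (wp u) \<otimes> wp v = wp r"
    using wp_teq[OF r S(2)] S(1) assms(1,2) by (simp add: wp_append inv_solve_left')
  ultimately show "weak_le W S (wp u) (wp v)"
    using assms S teq_length[OF r] by (simp add: weak_le_def cox_length_reduced)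
qed

text \<open>Reversing a word inverts its product and keeps it reduced, so being self-inverse is an
  equivalence of two reduced words.\<close>

lemma nontrivial_involution_iff:
  assumes "u \<in> lists S" "reduced u"
  shows "nontrivial_involution W (wp u) \<longleftrightarrow> u \<noteq> [] \<and> rev u \<approx> u"
proof -
  have "wp u = \<one> \<longleftrightarrow> u = []"
    using wp_eq_reduced_iff[of u "[]"] assms teq_length by fastforce
  moreover have "wp u [^] (2::nat) = \<one> \<longleftrightarrow> inv (wp u) = wp u"
    using wp_closed[OF assms(1)] inv_equality[of "wp u" "wp u"] l_inv[of "wp u"]
    by (metis numeral_2_eq_2 nat_pow_Suc nat_pow_0 l_one)
  moreover have "inv (wp u) = wp u \<longleftrightarrow> rev u \<approx> u"
    using assms wp_rev[of u] wp_eq_reduced_iff[of "rev u" u] reduced_rev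
    by (simp add: in_lists_conv_set)
  ultimately show ?thesis
    using assms by (simp add: nontrivial_involution_def)
qed

lemma ancestor:
  assumes w: "w \<in> carrier W" "w \<noteq> \<one>"
  shows "ancestor_property W S w"
proof -
  obtain U where U: "U \<in> lists S" "reduced U" "wp U = w"
    using reduced_word w by blast
  define P where "P X \<longleftrightarrow> X \<in> lists S \<and> reduced X \<and> X \<lesssim> U \<and> X \<noteq> [] \<and> rev X \<approx> X" for X
  have P_wp: "wp X \<in> weak_interval W S w \<and> nontrivial_involution W (wp X)" if "P X" for X
    using that U weak_le_iff[of X U] nontrivial_involution_iff[of X]
    by (auto simp: P_def weak_interval_def)
  have P_ex: "\<exists>X. P X \<and> x = wp X"
    if x: "x \<in> weak_interval W S w" "nontrivial_involution W x" for x
  proof -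
    obtain X where "X \<in> lists S" "reduced X" "wp X = x"
      using reduced_word x(2) nontrivial_involution_def by metis
    then show ?thesis
      using x U weak_le_iff[of X U] nontrivial_involution_iff[of X]
      by (auto simp: P_def weak_interval_def)
  qed
  have P_length: "cox_length W S (wp X) = length X" if "P X" for X
    using that cox_length_reduced by (simp add: P_def)
  obtain a U' where aU: "U = a # U'"
    using U w by (cases U) auto
  \<comment> \<open>The first letter of \<open>U\<close> is a palindrome and a prefix, so there is
    at least one candidate.\<close>
  have "P [a]"
    using U reduced_prefix[of "[a]" U'] tpre_iff_append[of "[a]" U] by (auto simp: P_def aU)
  \<comment> \<open>Candidates are prefixes of \<open>U\<close> up to commutations, so their lengths
    are strictly below \<open>Suc (length U)\<close> and a longest one exists.\<close>
  then obtain X where X: "P X" "\<And>Y. P Y \<Longrightarrow> length Y \<le> length X"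
    using ex_has_greatest_nat[of P "[a]" length "Suc (length U)"] tpre_length
    by (metis P_def less_Suc_eq_le)
  show ?thesis
    unfolding ancestor_property_def
  proof (rule ex1I[of _ "wp X"], goal_cases)
    case 1
    show ?case
      using X P_wp P_ex P_length by metis
  next
    case (2 y)
    then obtain Y where Y: "P Y" "y = wp Y"
      using P_ex by blast
    have "length X \<le> length Y"
      using 2 X(1) Y P_wp P_length by metis
    obtain Z where Z: "X \<lesssim> Z" "Y \<lesssim> Z" "Z \<lesssim> U" "rev Z \<approx> Z"
      using palindrome_join X(1) Y(1) P_def by metis
    obtain R where R: "Z @ R \<approx> U"
      using Z(3) tpre_iff_append by blast
    have "reduced Z"
      using reduced_cong[OF teq_sym[OF R]] U(2) reduced_prefix by blast
    moreover have "Z \<in> lists S"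
      using teq_set[OF R] U(1) by auto
    moreover have "Z \<noteq> []"
      using tpre_length[OF Z(1)] X(1) by (auto simp: P_def)
    ultimately have "length Z \<le> length X"
      using X(2) Z by (simp add: P_def)
    \<comment> \<open>\<open>Z\<close> is itself a candidate, so it is no longer than
      \<open>X\<close>, which is no longer than \<open>Y\<close>. Both lie below \<open>Z\<close>
      and so coincide with it up to commutations.\<close>
    then have "X \<approx> Z" "Y \<approx> Z"
      using tpre_length_eq Z \<open>length X \<le> length Y\<close> by auto
    then have "wp X = wp Z" "wp Y = wp Z"
      using wp_teq X(1) Y(1) by (auto simp: P_def)
    then show ?case
      using Y by simp
  qed
qed

end

section \<open>From the presentation to reduced words\<close>

lemma pres_rel_gwords: "(u, v) \<in> pres_rel S R \<Longrightarrow> u \<in> gwords S \<and> v \<in> gwords S"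
  by (induction rule: pres_rel.induct) simp_all

lemma equiv_pres_rel: "equiv (gwords S) (pres_rel S R)"
proof (rule equivI)
  show "pres_rel S R \<subseteq> gwords S \<times> gwords S"
    using pres_rel_gwords by fast
  show "refl_on (gwords S) (pres_rel S R)"
    by (simp add: refl_on_def pres_rel.refl)
  show "sym (pres_rel S R)"
    using pres_rel.sym by (auto intro!: symI)
  show "trans (pres_rel S R)"
    using pres_rel.trans by (auto intro!: transI)
qed

lemma pres_rel_context:
  assumes "(u, v) \<in> pres_rel S R" "p \<in> gwords S" "q \<in> gwords S"
  shows "(p @ u @ q, p @ v @ q) \<in> pres_rel S R"
  using assms
proof (induction rule: pres_rel.induct)
  case (refl u)
  then show ?case
    by (intro pres_rel.refl) simp
next
  case (sym u v)
  then show ?case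
    by (simp only: pres_rel.sym)
next
  case (trans u v w)
  from trans.IH[OF trans.prems] show ?case
    by (rule pres_rel.trans)
next
  case (cancel u v s b)
  then show ?case
    using pres_rel.cancel[of "p @ u" S "v @ q" s b R] by simp
next
  case (relator u v r)
  then show ?case
    using pres_rel.relator[of "p @ u" S "v @ q" r R] by simp
qed

lemma pres_rel_append:
  assumes "(u, u') \<in> pres_rel S R" "(v, v') \<in> pres_rel S R"
  shows "(u @ v, u' @ v') \<in> pres_rel S R"
proof (rule pres_rel.trans)
  show "(u @ v, u' @ v) \<in> pres_rel S R"
    using pres_rel_context[OF assms(1), of "[]" v] pres_rel_gwords[OF assms(2)] by simp
  show "(u' @ v, u' @ v') \<in> pres_rel S R"
    using pres_rel_context[OF assms(2), of u' "[]"] pres_rel_gwords[OF assms(1)] by simp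
qed

lemma pres_class_eq_iff:
  "u \<in> gwords S \<Longrightarrow> v \<in> gwords S \<Longrightarrow>
    pres_class S R u = pres_class S R v \<longleftrightarrow> (u, v) \<in> pres_rel S R"
  unfolding pres_class_def by (rule eq_equiv_class_iff[OF equiv_pres_rel])

text \<open>The product is a union over all representatives; concatenation respects the congruence,
  so the union is over a non-empty family with a single value.\<close>

lemma presented_group_mult:
  assumes "u \<in> gwords S" "v \<in> gwords S"
  shows "pres_class S R u \<otimes>\<^bsub>presented_group S R\<^esub> pres_class S R v = pres_class S R (u @ v)"
proof -
  have same: "pres_class S R (x @ y) = pres_class S R (u @ v)"
    if "x \<in> pres_class S R u" "y \<in> pres_class S R v" for x y
  proof -
    have "(u @ v, x @ y) \<in> pres_rel S R"
      using that pres_rel_append by (auto simp: pres_class_def)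
    then show ?thesis
      using pres_class_eq_iff pres_rel_gwords by metis
  qed
  have in_class: "u \<in> pres_class S R u" "v \<in> pres_class S R v"
    using assms by (auto simp: pres_class_def intro: pres_rel.refl)
  have "(\<Union>x\<in>pres_class S R u. \<Union>y\<in>pres_class S R v. pres_class S R (x @ y)) =
      (\<Union>x\<in>pres_class S R u. \<Union>y\<in>pres_class S R v. pres_class S R (u @ v))"
    by (intro SUP_cong same) simp_all
  also have "\<dots> = pres_class S R (u @ v)"
    using in_class by fast
  finally show ?thesis
    by (simp add: presented_group_def)
qed

section \<open>Coxeter relators and normal forms\<close>

lemma coxeter_relatorsI:
  "r \<in> S \<Longrightarrow> s \<in> S \<Longrightarrow> m r s = enat k \<Longrightarrow>
    concat (replicate k [(r, True), (s, True)]) \<in> coxeter_relators S m"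
  unfolding coxeter_relators_def by blast

text \<open>The defining relations hold, up to commutations, for the actions of the generators on
  reduced words. Forgetting signs by \<open>map fst\<close> is harmless because each
  \<open>act s\<close> is its own inverse there.\<close>

lemma (in commutation) pres_rel_nf:
  assumes m: "right_angled_coxeter_matrix S m"
    and C: "\<And>s t. C s t \<longleftrightarrow> s \<in> S \<and> t \<in> S \<and> s \<noteq> t \<and> m s t = 2"
    and rel: "(u, v) \<in> pres_rel S (coxeter_relators S m)"
  shows "nf (map fst u) \<approx> nf (map fst v)"
  using rel
proof (induction rule: pres_rel.induct)
  case (sym u v)
  then show ?case
    using teq_sym by blast
next
  case (trans u v w)
  then show ?case
    using teq_trans by blast
next
  case (cancel u v s b)
  show ?case
    using foldr_act_cong[OF act_act[OF reduced_nf[of "map fst v"]]] by (simp add: nf_def)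
next
  case (relator u v r)
  let ?x = "nf (map fst v)"
  obtain s t k where st: "s \<in> S" "t \<in> S" "m s t = enat k"
    and r: "r = concat (replicate k [(s, True), (t, True)])"
    using relator.hyps(3) by (auto simp: coxeter_relators_def)
  have "foldr act (map fst r) ?x \<approx> ?x"
  proof (cases "s = t")
    case True
    then have "k = 1"
      using m[unfolded right_angled_coxeter_matrix_def, rule_format, OF st(1,2)] st(3)
      by (simp add: one_enat_def)
    then have "map fst r = [s, s]"
      using True r by simp
    then show ?thesis
      using act_act[OF reduced_nf] by (simp only: foldr.simps comp_apply id_apply)
  next
    case False
    then have ms: "m s t = 2"
      using m[unfolded right_angled_coxeter_matrix_def, rule_format, OF st(1,2)] st(3) by auto
    then have k: "k = 2"
      using st by (simp add: numeral_eq_enat)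
    have "C s t"
      using False ms st by (simp add: C)
    then have "C t s"
      by (rule C_sym)
    \<comment> \<open>Swapping the two middle actions turns \<open>s t s t\<close> into
      \<open>s s t t\<close>, and both squares act trivially.\<close>
    have "act s (act t (act s (act t ?x))) \<approx> act s (act s (act t (act t ?x)))"
      by (intro act_cong act_commute \<open>C t s\<close>)
    also have "\<dots> \<approx> act t (act t ?x)"
      by (intro act_act reduced_act reduced_nf)
    also have "\<dots> \<approx> ?x"
      by (intro act_act reduced_nf)
    finally show ?thesis
      using k r by (simp add: numeral_2_eq_2)
  qed
  then show ?case
    using foldr_act_cong[of _ _ "map fst u"] by (simp add: nf_def)
qed auto

text \<open>Surjectivity of the isomorphism gives generation, the relators give the equations in
  \<open>W\<close>, and injectivity reduces the word problem in \<open>W\<close> to the congruence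
  on signed words.\<close>

lemma right_angled_coxeter_system_imp_right_angled:
  assumes "right_angled_coxeter_system W S"
  shows "\<exists>C. right_angled W S C"
proof -
  obtain m \<phi> where "group W" and S: "S \<subseteq> carrier W"
    and m: "right_angled_coxeter_matrix S m"
    and iso: "\<phi> \<in> iso (presented_group S (coxeter_relators S m)) W"
    and gen: "\<And>s. s \<in> S \<Longrightarrow> \<phi> (pres_class S (coxeter_relators S m) [(s, True)]) = s"
    using assms unfolding right_angled_coxeter_system_def by blast
  interpret W: group W by fact
  \<comment> \<open>\<open>C\<close> is false outside \<open>S\<close>, where the matrix is
    unconstrained and need not be symmetric.\<close>
  define C where "C s t \<longleftrightarrow> s \<in> S \<and> t \<in> S \<and> s \<noteq> t \<and> m s t = 2" for s t
  let ?R = "coxeter_relators S m"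
  let ?G = "presented_group S ?R"
  let ?c = "pres_class S ?R"
  let ?p = "map (\<lambda>s. (s, True))"
  interpret commutation C
    using m by unfold_locales (auto simp: C_def right_angled_coxeter_matrix_def)
  have carrier: "carrier ?G = ?c ` gwords S"
    by (auto simp: presented_group_def pres_class_def quotient_def)
  have c_closed: "?c u \<in> carrier ?G" if "u \<in> gwords S" for u
    using that carrier by blast
  have \<phi>_mult: "\<phi> (?c (u @ v)) = \<phi> (?c u) \<otimes>\<^bsub>W\<^esub> \<phi> (?c v)"
    if "u \<in> gwords S" "v \<in> gwords S" for u v
  proof -
    have "\<phi> \<in> hom ?G W"
      using iso by (simp add: iso_def)
    from hom_mult[OF this c_closed[OF that(1)] c_closed[OF that(2)]] show ?thesis
      by (simp only: presented_group_mult[OF that])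
  qed
  have \<phi>_closed: "\<phi> (?c u) \<in> carrier W" if "u \<in> gwords S" for u
    using iso c_closed[OF that] by (auto simp: iso_def hom_def)
  have \<phi>_one: "\<phi> (?c []) = \<one>\<^bsub>W\<^esub>"
    using \<phi>_mult[of "[]" "[]"] \<phi>_closed[of "[]"] W.l_cancel_one' by simp
  have \<phi>_wp: "\<phi> (?c (?p u)) = word_prod W u" if "u \<in> lists S" for u
    using that
  proof (induction u)
    case Nil
    then show ?case
      using \<phi>_one by (simp add: word_prod_def)
  next
    case (Cons a u)
    have "?p u \<in> gwords S"
      using Cons by auto
    then show ?case
      using Cons \<phi>_mult[of "[(a, True)]" "?p u"] gen by (simp add: word_prod_def)
  qed
  have wp_relator: "word_prod W u = \<one>\<^bsub>W\<^esub>" if "u \<in> lists S" "?p u \<in> ?R" for u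
  proof -
    have "?p u \<in> gwords S"
      using that(1) by auto
    moreover from this have "(?p u, []) \<in> pres_rel S ?R"
      using pres_rel.relator[of "[]" S "[]" "?p u" ?R] that(2) by simp
    ultimately have "?c (?p u) = ?c []"
      by (subst pres_class_eq_iff) auto
    then show ?thesis
      using \<phi>_wp[OF that(1)] \<phi>_one by simp
  qed
  have relator_square: "?p [s, s] \<in> ?R" if "s \<in> S" for s
  proof -
    have "m s s = enat 1"
      using that m by (simp add: right_angled_coxeter_matrix_def one_enat_def)
    then show ?thesis
      using coxeter_relatorsI[of s S s m 1] that by simp
  qed
  have square: "s \<otimes>\<^bsub>W\<^esub> s = \<one>\<^bsub>W\<^esub>" if "s \<in> S" for s
    using wp_relator[of "[s, s]"] relator_square[OF that] that S by (auto simp: word_prod_def)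
  have commute: "s \<otimes>\<^bsub>W\<^esub> t = t \<otimes>\<^bsub>W\<^esub> s" if st: "s \<in> S" "t \<in> S" "C s t" for s t
  proof -
    have c: "s \<in> carrier W" "t \<in> carrier W"
      using st S by auto
    have "?p [s, t, s, t] \<in> ?R"
      using coxeter_relatorsI[of s S t m 2] st
      by (simp add: C_def numeral_eq_enat numeral_2_eq_2)
    then have "(s \<otimes>\<^bsub>W\<^esub> t) \<otimes>\<^bsub>W\<^esub> (s \<otimes>\<^bsub>W\<^esub> t) = \<one>\<^bsub>W\<^esub>"
      using wp_relator[of "[s, t, s, t]"] st c by (simp add: word_prod_def W.m_assoc)
    then have "inv\<^bsub>W\<^esub> (s \<otimes>\<^bsub>W\<^esub> t) = s \<otimes>\<^bsub>W\<^esub> t"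
      using W.inv_equality c by simp
    moreover have "inv\<^bsub>W\<^esub> (s \<otimes>\<^bsub>W\<^esub> t) = t \<otimes>\<^bsub>W\<^esub> s"
      using W.inv_mult_group W.inv_equality square st c by metis
    ultimately show ?thesis
      by simp
  qed
  \<comment> \<open>A formal inverse can be replaced by its generator: the inverse of
    \<open>s\<close> followed by \<open>s s\<close> reduces to that inverse by the relator and to
    \<open>s\<close> by cancellation.\<close>
  have positive: "(u, ?p (map fst u)) \<in> pres_rel S ?R" if "u \<in> gwords S" for u
    using that
  proof (induction u)
    case Nil
    then show ?case
      by (simp add: pres_rel.refl)
  next
    case (Cons a u)
    obtain s b where a: "a = (s, b)" "s \<in> S"
      using Cons by (cases a) auto
    have "([(s, False), (s, True), (s, True)], [(s, False)]) \<in> pres_rel S ?R"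
      using pres_rel.relator[of "[(s, False)]" S "[]" "?p [s, s]" ?R] relator_square a by simp
    moreover have "([(s, False), (s, True), (s, True)], [(s, True)]) \<in> pres_rel S ?R"
      using pres_rel.cancel[of "[]" S "[(s, True)]" s False ?R] a by simp
    ultimately have "([(s, False)], [(s, True)]) \<in> pres_rel S ?R"
      using pres_rel.sym pres_rel.trans by blast
    moreover have "([(s, True)], [(s, True)]) \<in> pres_rel S ?R"
      using a by (intro pres_rel.refl) simp
    ultimately have "([(s, b)], [(s, True)]) \<in> pres_rel S ?R"
      by (cases b) auto
    then show ?case
      using pres_rel_append[of "[(s, b)]" "[(s, True)]" S ?R u] Cons a by simp
  qed
  have "right_angled W S C"
  proof (unfold_locales, goal_cases)
    case 1
    show ?case by (fact S)
  next
    case (2 g)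
    have "g \<in> \<phi> ` carrier ?G"
      using 2 iso by (auto simp: iso_def bij_betw_def)
    then have "g \<in> (\<lambda>u. \<phi> (?c u)) ` gwords S"
      by (simp only: carrier image_image)
    then obtain u where u: "g = \<phi> (?c u)" "u \<in> gwords S"
      by (rule imageE)
    have u': "map fst u \<in> lists S"
      using u(2) by fastforce
    have "?c u = ?c (?p (map fst u))"
      using positive[OF u(2)] pres_rel_gwords[OF positive[OF u(2)]]
      by (subst pres_class_eq_iff) simp_all
    then show ?case
      using u(1) u' \<phi>_wp[OF u'] by (intro bexI[of _ "map fst u"]) simp_all
  next
    case (3 s)
    then show ?case by (rule square)
  next
    case (4 s t)
    then show ?case by (rule commute)
  next
    case (5 u v)
    have g: "?p u \<in> gwords S" "?p v \<in> gwords S"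
      using 5 by auto
    have "\<phi> (?c (?p u)) = \<phi> (?c (?p v))"
      using 5 \<phi>_wp by simp
    moreover have "inj_on \<phi> (carrier ?G)"
      using iso by (auto simp: iso_def bij_betw_def)
    ultimately have "?c (?p u) = ?c (?p v)"
      using g c_closed inj_onD by metis
    then have "(?p u, ?p v) \<in> pres_rel S ?R"
      using g pres_class_eq_iff by metis
    from pres_rel_nf[OF m C_def this] show ?case
      by (simp add: comp_def)
  qed
  then show ?thesis
    by (rule exI[of _ C])
qed

theorem corollary1p3:
  fixes W :: "('a, 'b) monoid_scheme" and S :: "'a set" and w :: 'a
  assumes "right_angled_coxeter_system W S"
    and "w \<in> carrier W"
    and "w \<noteq> \<one>\<^bsub>W\<^esub>"
  shows "ancestor_property W S w"
proof -
  obtain C where "right_angled W S C"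
    using right_angled_coxeter_system_imp_right_angled[OF assms(1)] by (rule exE)
  then interpret right_angled W S C .
  show ?thesis
    using assms(2,3) by (rule ancestor)
qed

end
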